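(* Let $X$ be a uniformly ergodic time-homogeneous Markov chain on $\mathcal{X}$ under $\mathbb{P}$ with transition matrix $A$, and let $\gamma\in(0,1)$. Let $f,f':\mathcal{X}\times\mathbb{R}^N\to\mathbb{R}$ be such that the drivers $(\omega,t,z)\mapsto f(X_t(\omega),z)$ and $(\omega,t,z)\mapsto f'(X_t(\omega),z)$ are both $\gamma$-balanced, and let $(Y,Z,\lambda)$ and $(Y',Z',\lambda')$ be any bounded solutions of the Ergodic BSDEs with drivers $f$ and $f'$ respectively, i.e. a.s. for all $0\le t<T<\infty$ $$Y_T=Y_t-\sum_{t\le u<T}\big(f(X_u,Z_u)-\lambda\big)+\sum_{t\le u<T}Z_u^{*}M_{u+1},$$ $$Y'_T=Y'_t-\sum_{t\le u<T}\big(f'(X_u,Z'_u)-\lambda'\big)+\sum_{t\le u<T}(Z'_u)^{*}M_{u+1}.$$ If $f(x,z)\ge f'(x,z)$ for all $x\in\mathcal{X}$ and $z\in\mathbb{R}^N$, then $\lambda\ge\lambda'$.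
   Context: Setting. $\mathcal{X}=\{e_1,\dots,e_N\}$ is the standard basis of $\mathbb{R}^N$ (column vectors; $*$ is transposition), $X=(X_t)_{t\ge0}$ is an $\mathcal{X}$-valued process in discrete time $t\in\{0,1,2,\dots\}$ on a probability space $(\Omega,\mathcal{F},\mathbb{P})$, $\mathcal{F}_t$ is the $\mathbb{P}$-completion of $\sigma(X_0,\dots,X_t)$ (adding only subsets of null sets of $\sigma(X_0,\dots,X_t)$), and $\mathcal{F}=\sigma(\bigcup_t\mathcal{F}_t)$. Adapted means $\mathcal{F}_t$-measurable at each time $t$. Transition matrices are column-stochastic: $A=[a_{ij}]$, $a_{ij}=\mathbb{P}(X_{t+1}=e_i\mid X_t=e_j)$, so $\mathbb{E}[X_{t+1}\mid\mathcal{F}_t]=AX_t$. Put $M_{t+1}:=X_{t+1}-AX_t$. Uniform ergodicity: a time-homogeneous chain with $P_t\mu$ denoting the law of $X_t$ given $X_0\sim\mu$ is uniformly ergodic if there are a probability measure $\pi$ on $\mathcal{X}$ and $R,\rho>0$ with $\sup_\mu\|P_t\mu-\pi\|_{TV}\le Re^{-\rho t}$ for all $t\ge0$, the supremum being over probability measures on $\mathcal{X}$, where $\|\mu\|_{TV}=\frac12\sum_{x}|\mu(\{x\})|$. $\gamma$-balanced: a driver $f(\omega,t,z)$ (adapted: $(\omega,z)\mapsto f(\omega,t,z)$ is $\mathcal{F}_t\otimes\mathcal{B}(\mathbb{R}^N)$-measurable for each $t$) is $\gamma$-balanced if there is a map $\psi:\Omega\times\mathbb{N}\times\mathbb{R}^N\times\mathbb{R}^N\to\mathbb{R}^N$,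 adapted in the same sense, such that for all $t\ge0$, $z,z'\in\mathbb{R}^N$ and almost all $\omega$: (i) $f(\omega,t,z)-f(\omega,t,z')=(z-z')^*(\psi(\omega,t,z,z')-AX_t)$; (ii) for each $i$, $\frac{e_i^*\psi(\omega,t,z,z')}{e_i^*AX_t}\in[\gamma,\gamma^{-1}]$, with $0/0:=1$; (iii) the entries of $\psi(\omega,t,z,z')$ sum to $1$. A solution of the Ergodic BSDE is a triple $(Y,Z,\lambda)$ with $Y$ (real-valued) and $Z$ ($\mathbb{R}^N$-valued) adapted and $\lambda\in\mathbb{R}$ a constant; it is bounded if $Y$ is uniformly bounded. *)

theory Defs
  imports "HOL-Probability.Probability"
begin

text \<open>The state space is the standard basis of \<open>\<real>\<^sup>N\<close>, with \<open>N = CARD('n)\<close>.\<close>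

definition states :: "(real^'n) set" where
  "states = range (\<lambda>i. axis i 1)"

definition natural_sigma :: "'w measure \<Rightarrow> (nat \<Rightarrow> 'w \<Rightarrow> real^'n) \<Rightarrow> nat \<Rightarrow> 'w measure" where
  "natural_sigma M X t =
     sigma (space M) {X s -` B \<inter> space M | s B. s \<le> t \<and> B \<in> sets borel}"

text \<open>The filtration \<open>\<F>\<^sub>t\<close>. The completion is that of the restriction of the probability to
  \<open>\<sigma>(X\<^sub>0, \<dots>, X\<^sub>t)\<close>, so only subsets of null sets of \<open>\<sigma>(X\<^sub>0, \<dots>, X\<^sub>t)\<close> are added, and not all
  null sets of \<open>M\<close>.\<close>

definition filt :: "'w measure \<Rightarrow> (nat \<Rightarrow> 'w \<Rightarrow> real^'n) \<Rightarrow> nat \<Rightarrow> 'w measure" where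
  "filt M X t = completion (restr_to_subalg M (natural_sigma M X t))"

text \<open>Matrices act on column vectors: \<open>A $ i $ j\<close> is the probability of a step from
  \<open>axis j 1\<close> to \<open>axis i 1\<close>.\<close>

definition column_stochastic :: "real^'n^'n \<Rightarrow> bool" where
  "column_stochastic A \<longleftrightarrow> (\<forall>i j. 0 \<le> A $ i $ j) \<and> (\<forall>j. (\<Sum>i\<in>UNIV. A $ i $ j) = 1)"

text \<open>The initial law is arbitrary. In \<open>markov\<close>, conditioning is on the whole history
  \<open>X\<^sub>0, \<dots>, X\<^sub>t\<close> (whenever that history has positive probability), so this one clause contains the
  Markov property, time-homogeneity and the fact that \<open>A\<close> is the transition matrix.\<close>

locale markov_chain = prob_space M
  for M :: "'w measure" and X :: "nat \<Rightarrow> 'w \<Rightarrow> real^'n" and A :: "real^'n^'n" +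
  assumes X_measurable: "\<And>t. X t \<in> borel_measurable M"
    and X_states: "\<And>t \<omega>. \<omega> \<in> space M \<Longrightarrow> X t \<omega> \<in> states"
    and sets_eq: "sets M = sigma_sets (space M) (\<Union>t. sets (filt M X t))"
    and stochastic: "column_stochastic A"
    and markov: "\<And>t i h. \<P>(\<omega> in M. \<forall>s\<le>t. X s \<omega> = axis (h s) 1) > 0 \<Longrightarrow>
        \<P>(\<omega> in M. X (Suc t) \<omega> = axis i 1 \<bar> \<forall>s\<le>t. X s \<omega> = axis (h s) 1) = A $ i $ h t"

text \<open>Probability measures on the state space are represented by \<open>'n pmf\<close>, the mass at \<open>i\<close> being
  that of the state \<open>axis i 1\<close>. The law of \<open>X\<^sub>t\<close> given \<open>X\<^sub>0 \<sim> \<mu>\<close> is obtained by iterating the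
  one-step transition kernel; see \<open>law_of_chain\<close> below.\<close>

definition step_law :: "real^'n^'n \<Rightarrow> 'n \<Rightarrow> 'n pmf" where
  "step_law A j = embed_pmf (\<lambda>i. A $ i $ j)"

primrec chain_law :: "real^'n^'n \<Rightarrow> 'n pmf \<Rightarrow> nat \<Rightarrow> 'n pmf" where
  "chain_law A \<mu> 0 = \<mu>"
| "chain_law A \<mu> (Suc t) = bind_pmf (chain_law A \<mu> t) (step_law A)"

definition tv_dist :: "'n::finite pmf \<Rightarrow> 'n pmf \<Rightarrow> real" where
  "tv_dist \<mu> \<nu> = (\<Sum>i\<in>UNIV. \<bar>pmf \<mu> i - pmf \<nu> i\<bar>) / 2"

definition uniformly_ergodic :: "real^'n^'n \<Rightarrow> bool" where
  "uniformly_ergodic A \<longleftrightarrow>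
     (\<exists>\<pi> R \<rho>. R > 0 \<and> \<rho> > 0 \<and>
        (\<forall>t. \<forall>\<mu>. tv_dist (chain_law A \<mu> t) \<pi> \<le> R * exp (- \<rho> * real t)))"

lemma pmf_step_law:
  assumes "column_stochastic A"
  shows "pmf (step_law A j) i = A $ i $ j"
proof -
  have "(\<integral>\<^sup>+i. ennreal (A $ i $ j) \<partial>count_space UNIV) = 1"
    using assms by (simp add: nn_integral_count_space_finite column_stochastic_def)
  with assms show ?thesis
    unfolding step_law_def by (intro pmf_embed_pmf) (auto simp: column_stochastic_def)
qed

lemma pmf_chain_law_Suc:
  assumes "column_stochastic A"
  shows "pmf (chain_law A \<mu> (Suc t)) i = (\<Sum>j\<in>UNIV. A $ i $ j * pmf (chain_law A \<mu> t) j)"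
  by (simp add: pmf_bind pmf_step_law[OF assms] integral_measure_pmf_real[of UNIV])

lemma (in markov_chain) step:
  "\<P>(\<omega> in M. X (Suc t) \<omega> = axis i 1 \<and> X t \<omega> = axis j 1) = A $ i $ j * \<P>(\<omega> in M. X t \<omega> = axis j 1)"
proof -
  define H where "H = {h \<in> PiE {..t} (\<lambda>_. UNIV :: 'n set). h t = j}"
  define E where "E h = {\<omega> \<in> space M. \<forall>s\<le>t. X s \<omega> = axis (h s) 1}" for h :: "nat \<Rightarrow> 'n"
  define B where "B = {\<omega> \<in> space M. X (Suc t) \<omega> = axis i 1}"
  note [measurable] = X_measurable
  have finH: "finite H" unfolding H_def by (simp add: finite_PiE)
  have E[measurable]: "E h \<in> sets M" for h unfolding E_def by measurable
  have B[measurable]: "B \<in> sets M" unfolding B_def by measurable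
  have disj: "disjoint_family_on E H"
  proof (unfold disjoint_family_on_def, intro ballI impI)
    fix g h assume gh: "g \<in> H" "h \<in> H" "g \<noteq> h"
    then obtain s where "s \<le> t" "g s \<noteq> h s"
      unfolding H_def by (metis (no_types, lifting) PiE_ext atMost_iff mem_Collect_eq)
    then show "E g \<inter> E h = {}" by (auto simp: E_def axis_eq_axis)
  qed
  have cover: "{\<omega> \<in> space M. X t \<omega> = axis j 1} = (\<Union>h\<in>H. E h)"
  proof (intro equalityI subsetI)
    fix \<omega> assume w: "\<omega> \<in> {\<omega> \<in> space M. X t \<omega> = axis j 1}"
    then have "\<forall>s. \<exists>k. X s \<omega> = axis k 1" using X_states unfolding states_def by blast
    then obtain k where k: "\<And>s. X s \<omega> = axis (k s) 1" by metis
    have "axis (k t) (1::real) = axis j 1" using w k[of t] by simp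
    then have "k t = j" by (simp add: axis_eq_axis)
    then have "restrict k {..t} \<in> H" "\<omega> \<in> E (restrict k {..t})"
      using w k by (auto simp: H_def E_def)
    then show "\<omega> \<in> (\<Union>h\<in>H. E h)" by blast
  qed (auto simp: E_def H_def)
  have one: "prob (B \<inter> E h) = A $ i $ j * prob (E h)" if "h \<in> H" for h
  proof (cases "prob (E h) > 0")
    case True
    have eq: "{\<omega> \<in> space M. X (Suc t) \<omega> = axis i 1 \<and> (\<forall>s\<le>t. X s \<omega> = axis (h s) 1)} = B \<inter> E h"
      by (auto simp: B_def E_def)
    from True markov[of t h i] that show ?thesis
      by (simp add: cond_prob_def eq E_def[symmetric] H_def divide_eq_eq)
  next
    case False
    then have "prob (E h) = 0" by (simp add: zero_less_measure_iff)
    moreover have "prob (B \<inter> E h) \<le> prob (E h)" by (intro finite_measure_mono) auto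
    ultimately show ?thesis by (simp add: measure_le_0_iff)
  qed
  have "{\<omega> \<in> space M. X (Suc t) \<omega> = axis i 1 \<and> X t \<omega> = axis j 1} = (\<Union>h\<in>H. B \<inter> E h)"
    using cover by (auto simp: B_def)
  then have "\<P>(\<omega> in M. X (Suc t) \<omega> = axis i 1 \<and> X t \<omega> = axis j 1) = prob (\<Union>h\<in>H. B \<inter> E h)"
    by simp
  also have "\<dots> = (\<Sum>h\<in>H. prob (B \<inter> E h))"
    using disj by (intro finite_measure_finite_Union finH) (auto simp: disjoint_family_on_def)
  also have "\<dots> = A $ i $ j * (\<Sum>h\<in>H. prob (E h))"
    by (simp add: one sum_distrib_left)
  also have "(\<Sum>h\<in>H. prob (E h)) = prob (\<Union>h\<in>H. E h)"
    using disj by (intro finite_measure_finite_Union[symmetric] finH) auto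
  finally show ?thesis by (simp add: cover)
qed

lemma (in markov_chain) law_of_chain:
  assumes "\<And>i. \<P>(\<omega> in M. X 0 \<omega> = axis i 1) = pmf \<mu> i"
  shows "\<P>(\<omega> in M. X t \<omega> = axis i 1) = pmf (chain_law A \<mu> t) i"
proof (induction t arbitrary: i)
  case 0
  then show ?case using assms by simp
next
  case (Suc t)
  note [measurable] = X_measurable
  define B where "B j = {\<omega> \<in> space M. X (Suc t) \<omega> = axis i 1 \<and> X t \<omega> = axis j 1}" for j
  have [measurable]: "B j \<in> sets M" for j unfolding B_def by measurable
  have "{\<omega> \<in> space M. X (Suc t) \<omega> = axis i 1} = (\<Union>j\<in>UNIV. B j)"
    using X_states[of _ t] unfolding states_def B_def by blast
  then have "\<P>(\<omega> in M. X (Suc t) \<omega> = axis i 1) = prob (\<Union>j\<in>UNIV. B j)" by simp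
  also have "\<dots> = (\<Sum>j\<in>UNIV. prob (B j))"
    by (intro finite_measure_finite_Union) (auto simp: disjoint_family_on_def B_def axis_eq_axis)
  also have "\<dots> = pmf (chain_law A \<mu> (Suc t)) i"
    by (simp only: B_def step Suc.IH pmf_chain_law_Suc[OF stochastic])
  finally show ?case .
qed

text \<open>The quotient convention \<open>0/0 = 1\<close>. A quotient \<open>a/0\<close> with \<open>a \<noteq> 0\<close> has the HOL value \<open>0\<close>, which
  lies outside \<open>{\<gamma>..1/\<gamma>}\<close> for \<open>\<gamma> > 0\<close>, so that \<open>balanced\<close> excludes it.\<close>

definition ratio :: "real \<Rightarrow> real \<Rightarrow> real" where
  "ratio a b = (if a = 0 \<and> b = 0 then 1 else a / b)"

definition balanced ::
  "'w measure \<Rightarrow> (nat \<Rightarrow> 'w \<Rightarrow> real^'n) \<Rightarrow> real^'n^'n \<Rightarrow> real \<Rightarrow>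
   ('w \<Rightarrow> nat \<Rightarrow> real^'n \<Rightarrow> real) \<Rightarrow> bool" where
  "balanced M X A \<gamma> f \<longleftrightarrow>
     (\<forall>t. (\<lambda>(\<omega>, z). f \<omega> t z) \<in> borel_measurable (filt M X t \<Otimes>\<^sub>M borel)) \<and>
     (\<exists>\<psi> :: 'w \<Rightarrow> nat \<Rightarrow> real^'n \<Rightarrow> real^'n \<Rightarrow> real^'n.
        (\<forall>t. (\<lambda>(\<omega>, z, z'). \<psi> \<omega> t z z')
               \<in> borel_measurable (filt M X t \<Otimes>\<^sub>M borel \<Otimes>\<^sub>M borel)) \<and>
        (\<forall>t z z'. AE \<omega> in M.
           f \<omega> t z - f \<omega> t z' = (z - z') \<bullet> (\<psi> \<omega> t z z' - A *v X t \<omega>) \<and>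
           (\<forall>i. ratio (\<psi> \<omega> t z z' $ i) ((A *v X t \<omega>) $ i) \<in> {\<gamma>..inverse \<gamma>}) \<and>
           (\<Sum>i\<in>UNIV. \<psi> \<omega> t z z' $ i) = 1))"

definition martingale_diff ::
  "(nat \<Rightarrow> 'w \<Rightarrow> real^'n) \<Rightarrow> real^'n^'n \<Rightarrow> nat \<Rightarrow> 'w \<Rightarrow> real^'n" where
  "martingale_diff X A t \<omega> = X t \<omega> - A *v X (t - 1) \<omega>"

definition ebsde_solution ::
  "'w measure \<Rightarrow> (nat \<Rightarrow> 'w \<Rightarrow> real^'n) \<Rightarrow> real^'n^'n \<Rightarrow> ('w \<Rightarrow> nat \<Rightarrow> real^'n \<Rightarrow> real) \<Rightarrow>
   (nat \<Rightarrow> 'w \<Rightarrow> real) \<Rightarrow> (nat \<Rightarrow> 'w \<Rightarrow> real^'n) \<Rightarrow> real \<Rightarrow> bool" where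
  "ebsde_solution M X A f Y Z lam \<longleftrightarrow>
     (\<forall>t. Y t \<in> borel_measurable (filt M X t)) \<and>
     (\<forall>t. Z t \<in> borel_measurable (filt M X t)) \<and>
     (AE \<omega> in M. \<forall>t T. t < T \<longrightarrow>
        Y T \<omega> = Y t \<omega> - (\<Sum>u = t..<T. (f \<omega> u (Z u \<omega>) - lam))
                      + (\<Sum>u = t..<T. Z u \<omega> \<bullet> martingale_diff X A (Suc u) \<omega>))"

definition bounded_solution ::
  "'w measure \<Rightarrow> (nat \<Rightarrow> 'w \<Rightarrow> real^'n) \<Rightarrow> real^'n^'n \<Rightarrow> ('w \<Rightarrow> nat \<Rightarrow> real^'n \<Rightarrow> real) \<Rightarrow>
   (nat \<Rightarrow> 'w \<Rightarrow> real) \<Rightarrow> (nat \<Rightarrow> 'w \<Rightarrow> real^'n) \<Rightarrow> real \<Rightarrow> bool" where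
  "bounded_solution M X A f Y Z lam \<longleftrightarrow>
     ebsde_solution M X A f Y Z lam \<and> (\<exists>C. AE \<omega> in M. \<forall>t. \<bar>Y t \<omega>\<bar> \<le> C)"

end

theory Submission
  imports Defs
begin

text \<open>Put \<open>D = Y - Y'\<close> and \<open>d = Z - Z'\<close>. Balancedness of \<open>f\<close> and \<open>f \<ge> f'\<close> give
  \<open>D\<^bsub>t+1\<^esub> \<le> D\<^sub>t + (\<lambda> - \<lambda>') + d\<^sub>t \<bullet> (X\<^bsub>t+1\<^esub> - \<psi>\<^sub>t)\<close>, where \<open>\<psi>\<^sub>t\<close> is a probability vector
  supported in the support of \<open>A X\<^sub>t\<close>. A weighted mean is at least one of its terms, so from every
  history of positive probability some state \<open>e\<^sub>i\<close> that is reached with positive probability has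
  \<open>d\<^sub>t \<bullet> e\<^sub>i \<le> d\<^sub>t \<bullet> \<psi>\<^sub>t\<close>. Along this step \<open>D\<close> grows by at most \<open>\<lambda> - \<lambda>'\<close>. If
  \<open>\<lambda> < \<lambda>'\<close>, then iterating produces histories of positive probability on which \<open>D\<close> is arbitrarily
  negative, against boundedness.\<close>

text \<open>Otherwise \<open>d\<close> would exceed its mean at every index of positive weight, and
  averaging would put the mean strictly above itself. Keeping \<open>p i > 0\<close> in the
  conclusion is what later makes the chosen state reachable.\<close>

lemma exists_le_weighted_mean:
  fixes p d :: "'i::finite \<Rightarrow> real"
  assumes "\<And>i. 0 \<le> p i" and "sum p UNIV = 1"
  shows "\<exists>i. p i > 0 \<and> d i \<le> (\<Sum>i\<in>UNIV. d i * p i)"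
proof (rule ccontr)
  define m where "m = (\<Sum>i\<in>UNIV. d i * p i)"
  assume "\<not> ?thesis"
  then have less: "p i > 0 \<Longrightarrow> m < d i" for i
    by (force simp: m_def)
  obtain k where "p k > 0"
    using assms sum_nonpos[of UNIV p] by (force simp: not_less)
  have "(\<Sum>i\<in>UNIV. m * p i) < (\<Sum>i\<in>UNIV. d i * p i)"
  proof (rule sum_strict_mono_ex1)
    show "\<forall>i\<in>UNIV. m * p i \<le> d i * p i"
      using less assms(1) by (metis less_eq_real_def mult_right_mono mult_zero_right)
    show "\<exists>i\<in>UNIV. m * p i < d i * p i"
      using less \<open>p k > 0\<close> by (intro bexI[of _ k]) auto
  qed simp
  then show False
    using assms(2) by (simp add: m_def flip: sum_distrib_left)
qed

text \<open>If \<open>a\<close> is nonzero, the convention for 0/0 does not apply and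
  \<open>a / b\<close> is at least \<gamma> > 0. This excludes \<open>b = 0\<close>, where the HOL
  quotient would be 0, so both numbers are positive.\<close>

lemma ratio_bounds_imp:
  assumes "ratio a b \<in> {\<gamma>..inverse \<gamma>}" "0 < \<gamma>" "0 \<le> b"
  shows "0 \<le> a" and "0 < a \<Longrightarrow> 0 < b"
proof -
  have "0 < a \<and> 0 < b" if "a \<noteq> 0"
  proof -
    have "0 < a / b"
      using assms(1,2) that by (auto simp: ratio_def)
    with assms(3) show ?thesis
      by (auto simp: zero_less_divide_iff)
  qed
  then show "0 \<le> a" and "0 < a \<Longrightarrow> 0 < b"
    by (cases "a = 0"; simp)+
qed

context markov_chain
begin

definition history :: "nat \<Rightarrow> (nat \<Rightarrow> 'n) \<Rightarrow> 'w set" where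
  "history t h = {\<omega> \<in> space M. \<forall>s\<le>t. X s \<omega> = axis (h s) 1}"

lemma sets_history [measurable]: "history t h \<in> sets M"
proof -
  note [measurable] = X_measurable
  show ?thesis unfolding history_def by measurable
qed

lemma sets_natural_sigma:
  "sets (natural_sigma M X t) =
    sigma_sets (space M) {X s -` B \<inter> space M | s B. s \<le> t \<and> B \<in> sets borel}"
  unfolding natural_sigma_def by (rule sets_measure_of) auto

lemma subalgebra_natural_sigma: "subalgebra M (natural_sigma M X t)"
proof -
  have "sets (natural_sigma M X t) \<subseteq> sets M"
    unfolding sets_natural_sigma
    using measurable_sets[OF X_measurable] by (intro sets.sigma_sets_subset) blast
  then show ?thesis
    by (simp add: subalgebra_def natural_sigma_def space_measure_of_conv)
qed

text \<open>Every \<open>X s\<close> with \<open>s \<le> t\<close> is constant on a history, so each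
  generator contains or misses it. This property passes to complements and countable unions.\<close>

lemma natural_sigma_history_atom:
  assumes "S \<in> sets (natural_sigma M X t)"
  shows "history t h \<subseteq> S \<or> history t h \<inter> S = {}"
proof -
  have "S \<in> sigma_sets (space M) {X s -` B \<inter> space M | s B. s \<le> t \<and> B \<in> sets borel}"
    using assms by (simp only: sets_natural_sigma)
  then show ?thesis
  proof induction
    case (Basic S)
    then show ?case by (auto simp: history_def)
  next
    case (Compl S)
    then show ?case by (auto simp: history_def)
  qed blast+
qed

text \<open>Completion changes a function only on a null set: \<open>g\<close> agrees almost surely
  with some \<open>g'\<close> measurable for the uncompleted \<sigma>-algebra, and \<open>g'\<close>
  is constant on its atoms.\<close>

lemma AE_const_on_history_real:
  fixes g :: "'w \<Rightarrow> real"
  assumes "g \<in> borel_measurable (filt M X t)"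
  shows "\<exists>c. AE \<omega> in M. \<omega> \<in> history t h \<longrightarrow> g \<omega> = c"
proof (cases "history t h = {}")
  case False
  then obtain \<omega>0 where w0: "\<omega>0 \<in> history t h" by blast
  let ?R = "restr_to_subalg M (natural_sigma M X t)"
  obtain g' where g': "g' \<in> borel_measurable ?R" "AE \<omega> in ?R. g \<omega> = g' \<omega>"
    using completion_ex_borel_measurable_real assms unfolding filt_def by blast
  have "g' \<omega> = g' \<omega>0" if "\<omega> \<in> history t h" for \<omega>
  proof -
    \<comment> \<open>This level set meets the history in \<open>\<omega>0\<close>, so it must
      contain the whole history.\<close>
    have "g' -` {g' \<omega>0} \<inter> space ?R \<in> sets ?R"
      using g'(1) by (rule measurable_sets) simp
    then have "g' -` {g' \<omega>0} \<inter> space M \<in> sets (natural_sigma M X t)"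
      by (simp add: sets_restr_to_subalg[OF subalgebra_natural_sigma] space_restr_to_subalg)
    from natural_sigma_history_atom[OF this, of h] w0 that show ?thesis
      by (auto simp: history_def)
  qed
  moreover have "AE \<omega> in M. g \<omega> = g' \<omega>"
    using AE_restr_to_subalg[OF subalgebra_natural_sigma g'(2)] .
  ultimately show ?thesis by (intro exI[of _ "g' \<omega>0"]) auto
qed simp

lemma AE_const_on_history:
  fixes g :: "'w \<Rightarrow> real^'m"
  assumes "g \<in> borel_measurable (filt M X t)"
  shows "\<exists>c. AE \<omega> in M. \<omega> \<in> history t h \<longrightarrow> g \<omega> = c"
proof -
  have "\<exists>c. AE \<omega> in M. \<omega> \<in> history t h \<longrightarrow> g \<omega> $ i = c" for i
    using assms by (intro AE_const_on_history_real measurable_compose[OF _ borel_measurable_nth])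
  then obtain c where "\<And>i. AE \<omega> in M. \<omega> \<in> history t h \<longrightarrow> g \<omega> $ i = c i"
    by metis
  then have "AE \<omega> in M. \<forall>i. \<omega> \<in> history t h \<longrightarrow> g \<omega> $ i = c i"
    by (intro AE_all_countable[THEN iffD2] allI)
  then show ?thesis
    by (intro exI[of _ "\<chi> i. c i"]) (auto simp: vec_eq_iff)
qed

lemma AE_notin_history_iff: "(AE \<omega> in M. \<omega> \<notin> history t h) \<longleftrightarrow> prob (history t h) = 0"
  using AE_iff_null_sets[OF sets_history, of t h]
  by (simp add: null_sets_def emeasure_eq_measure)

lemma AE_history_witness:
  assumes "prob (history t h) > 0" "AE \<omega> in M. P \<omega>"
  obtains \<omega> where "\<omega> \<in> history t h" "P \<omega>"
proof -
  have "AE \<omega> in M. \<omega> \<notin> history t h" if "\<And>\<omega>. \<omega> \<in> history t h \<Longrightarrow> \<not> P \<omega>"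
    using assms(2) by eventually_elim (use that in blast)
  with assms(1) AE_notin_history_iff[of t h] show thesis
    using that by fastforce
qed

text \<open>The histories at time 0 cover the space and are finitely many, so they cannot all be
  null.\<close>

lemma history_0_pos: "\<exists>h. prob (history 0 h) > 0"
proof (rule ccontr)
  assume "\<nexists>h. prob (history 0 h) > 0"
  then have "AE \<omega> in M. \<omega> \<notin> history 0 (\<lambda>_. i)" for i
    unfolding AE_notin_history_iff by (metis measure_nonneg order_le_less)
  then have "AE \<omega> in M. \<forall>i. \<omega> \<notin> history 0 (\<lambda>_. i)"
    by (simp add: AE_all_countable)
  moreover have "AE \<omega> in M. \<exists>i. \<omega> \<in> history 0 (\<lambda>_. i)"
    using X_states[of _ 0] by (intro AE_I2) (auto simp: history_def states_def image_iff)
  ultimately have "AE \<omega> in M. False"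
    by eventually_elim blast
  then show False by simp
qed

lemma history_Suc_pos:
  assumes "prob (history t h) > 0" "A $ i $ h t > 0"
  shows "prob (history (Suc t) (h(Suc t := i))) > 0"
proof -
  have eq: "history (Suc t) (h(Suc t := i)) =
      {\<omega> \<in> space M. X (Suc t) \<omega> = axis i 1 \<and> (\<forall>s\<le>t. X s \<omega> = axis (h s) 1)}"
    by (auto simp: history_def le_Suc_eq)
  have "prob (history (Suc t) (h(Suc t := i))) / prob (history t h) = A $ i $ h t"
    using markov[of t h i] assms(1) unfolding cond_prob_def eq by (simp only: history_def)
  with assms show ?thesis
    by (metis zero_less_divide_iff less_asym)
qed

lemma history_Suc_subset: "history (Suc t) (h(Suc t := i)) \<subseteq> history t h"
  by (auto simp: history_def)

end

lemma bounded_solution_step: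
  assumes "bounded_solution M X A g Y Z lam"
  shows "AE \<omega> in M. Y (Suc t) \<omega>
    = Y t \<omega> - (g \<omega> t (Z t \<omega>) - lam) + Z t \<omega> \<bullet> (X (Suc t) \<omega> - A *v X t \<omega>)"
proof -
  have "AE \<omega> in M. \<forall>t T. t < T \<longrightarrow>
        Y T \<omega> = Y t \<omega> - (\<Sum>u = t..<T. (g \<omega> u (Z u \<omega>) - lam))
                      + (\<Sum>u = t..<T. Z u \<omega> \<bullet> martingale_diff X A (Suc u) \<omega>)"
    using assms unfolding bounded_solution_def ebsde_solution_def by blast
  then show ?thesis
  proof eventually_elim
    case (elim \<omega>)
    from elim[rule_format, of t "Suc t"] show ?case
      by (simp add: martingale_diff_def)
  qed
qed

text \<open>The null set in \<open>balanced\<close> may depend on \<open>z\<close> and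
  \<open>z'\<close>, so these are fixed vectors here. The driver sees \<omega> only through
  \<open>X t \<omega>\<close>, so a single good sample point on the history yields a deterministic
  inequality.\<close>

lemma (in markov_chain) balanced_step:
  assumes bal: "balanced M X A \<gamma> (\<lambda>\<omega> t z. f (X t \<omega>) z)" and "0 < \<gamma>"
    and pos: "prob (history t h) > 0"
  shows "\<exists>i. A $ i $ h t > 0 \<and>
    (z - z') \<bullet> (axis i 1 - A *v axis (h t) 1) \<le> f (axis (h t) 1) z - f (axis (h t) 1) z'"
proof -
  let ?x = "axis (h t) 1 :: real^'n"
  from bal obtain \<psi> where "\<forall>t z z'. AE \<omega> in M.
      f (X t \<omega>) z - f (X t \<omega>) z' = (z - z') \<bullet> (\<psi> \<omega> t z z' - A *v X t \<omega>) \<and>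
      (\<forall>i. ratio (\<psi> \<omega> t z z' $ i) ((A *v X t \<omega>) $ i) \<in> {\<gamma>..inverse \<gamma>}) \<and>
      (\<Sum>i\<in>UNIV. \<psi> \<omega> t z z' $ i) = 1"
    unfolding balanced_def by blast
  from this[rule_format] obtain \<omega> where w: "\<omega> \<in> history t h" and
    w': "f (X t \<omega>) z - f (X t \<omega>) z' = (z - z') \<bullet> (\<psi> \<omega> t z z' - A *v X t \<omega>) \<and>
      (\<forall>i. ratio (\<psi> \<omega> t z z' $ i) ((A *v X t \<omega>) $ i) \<in> {\<gamma>..inverse \<gamma>}) \<and>
      (\<Sum>i\<in>UNIV. \<psi> \<omega> t z z' $ i) = 1"
    by (rule AE_history_witness[OF pos])
  define p where "p = \<psi> \<omega> t z z'"
  have Xt: "X t \<omega> = ?x" using w by (simp add: history_def)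
  have col: "(A *v ?x) $ i = A $ i $ h t" for i
    by (simp add: matrix_vector_mult_basis column_def)
  have nonneg: "0 \<le> A $ i $ h t" for i
    using stochastic by (simp add: column_stochastic_def)
  have p: "f ?x z - f ?x z' = (z - z') \<bullet> (p - A *v ?x)" "(\<Sum>i\<in>UNIV. p $ i) = 1"
    "\<And>i. ratio (p $ i) (A $ i $ h t) \<in> {\<gamma>..inverse \<gamma>}"
    using w' by (auto simp: p_def Xt col)
  have p_nonneg: "0 \<le> p $ i" and p_supp: "0 < p $ i \<Longrightarrow> 0 < A $ i $ h t" for i
    using ratio_bounds_imp[OF p(3) \<open>0 < \<gamma>\<close> nonneg, of i] by blast+
  \<comment> \<open>The bounds on the ratios make \<open>p\<close> a probability vector supported
    where column \<open>h t\<close> of \<open>A\<close> is positive.\<close>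
  obtain i where "0 < p $ i" "(z - z') $ i \<le> (\<Sum>i\<in>UNIV. (z - z') $ i * p $ i)"
    using exists_le_weighted_mean[of "\<lambda>i. p $ i" "\<lambda>i. (z - z') $ i", OF p_nonneg p(2)] by blast
  then have "A $ i $ h t > 0" "(z - z') $ i \<le> (z - z') \<bullet> p"
    by (simp_all add: p_supp inner_vec_def)
  then show ?thesis
    by (intro exI[of _ i]) (simp add: p(1) inner_diff_right inner_axis)
qed

theorem theorem4p8:
  fixes M :: "'w measure"
    and X :: "nat \<Rightarrow> 'w \<Rightarrow> real^'n"
    and A :: "real^'n^'n"
    and \<gamma> lam lam' :: real
    and f f' :: "real^'n \<Rightarrow> real^'n \<Rightarrow> real"
    and Y Y' :: "nat \<Rightarrow> 'w \<Rightarrow> real"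
    and Z Z' :: "nat \<Rightarrow> 'w \<Rightarrow> real^'n"
  assumes "markov_chain M X A"
    and "uniformly_ergodic A"
    and "0 < \<gamma>" and "\<gamma> < 1"
    and "balanced M X A \<gamma> (\<lambda>\<omega> t z. f (X t \<omega>) z)"
    and "balanced M X A \<gamma> (\<lambda>\<omega> t z. f' (X t \<omega>) z)"
    and "bounded_solution M X A (\<lambda>\<omega> t z. f (X t \<omega>) z) Y Z lam"
    and "bounded_solution M X A (\<lambda>\<omega> t z. f' (X t \<omega>) z) Y' Z' lam'"
    and "\<And>x z. x \<in> states \<Longrightarrow> f x z \<ge> f' x z"
  shows "lam \<ge> lam'"
proof (rule ccontr)
  assume "\<not> lam \<ge> lam'"
  then have neg: "lam < lam'" by simp
  interpret markov_chain M X A by fact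
  obtain C C' where C: "AE \<omega> in M. \<forall>t. \<bar>Y t \<omega>\<bar> \<le> C" and C': "AE \<omega> in M. \<forall>t. \<bar>Y' t \<omega>\<bar> \<le> C'"
    using assms(7,8) unfolding bounded_solution_def by blast
  \<comment> \<open>The history depends on \<open>t\<close> and is extended by one well-chosen state
    at each step, at a gain of at most \<open>lam - lam'\<close>.\<close>
  have descent: "\<exists>h. prob (history t h) > 0 \<and>
      (AE \<omega> in M. \<omega> \<in> history t h \<longrightarrow> Y t \<omega> - Y' t \<omega> \<le> C + C' + real t * (lam - lam'))" for t
  proof (induction t)
    case 0
    have "AE \<omega> in M. Y 0 \<omega> - Y' 0 \<omega> \<le> C + C'"
      using C C'
    proof eventually_elim
      case (elim \<omega>)
      then have "\<bar>Y 0 \<omega>\<bar> \<le> C" "\<bar>Y' 0 \<omega>\<bar> \<le> C'" by blast+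
      then show ?case by linarith
    qed
    with history_0_pos show ?case by auto
  next
    case (Suc t)
    then obtain h where pos: "prob (history t h) > 0" and
      IH: "AE \<omega> in M. \<omega> \<in> history t h \<longrightarrow> Y t \<omega> - Y' t \<omega> \<le> C + C' + real t * (lam - lam')"
      by blast
    let ?x = "axis (h t) 1 :: real^'n"
    have "Z t \<in> borel_measurable (filt M X t)" "Z' t \<in> borel_measurable (filt M X t)"
      using assms(7,8) unfolding bounded_solution_def ebsde_solution_def by blast+
    \<comment> \<open>Adaptedness replaces the random \<open>Z t\<close> and \<open>Z' t\<close> by
      constants on the history, as \<open>balanced_step\<close> requires.\<close>
    from this[THEN AE_const_on_history] obtain z z' where
      z: "AE \<omega> in M. \<omega> \<in> history t h \<longrightarrow> Z t \<omega> = z" and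
      z': "AE \<omega> in M. \<omega> \<in> history t h \<longrightarrow> Z' t \<omega> = z'"
      by metis
    from balanced_step[OF assms(5,3) pos] obtain i where i: "A $ i $ h t > 0"
      "(z - z') \<bullet> (axis i 1 - A *v ?x) \<le> f ?x z - f ?x z'"
      by blast
    \<comment> \<open>The drivers are compared at \<open>z'\<close>, since balancedness of
      \<open>f\<close> handles the change from \<open>z\<close> to \<open>z'\<close>.\<close>
    have cmp: "f' ?x z' \<le> f ?x z'"
      by (intro assms(9)) (simp add: states_def)
    let ?h = "h(Suc t := i)"
    have "AE \<omega> in M. \<omega> \<in> history (Suc t) ?h \<longrightarrow>
        Y (Suc t) \<omega> - Y' (Suc t) \<omega> \<le> C + C' + real (Suc t) * (lam - lam')"
      using IH z z' bounded_solution_step[OF assms(7), of t] bounded_solution_step[OF assms(8), of t]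
    proof eventually_elim
      case (elim \<omega>)
      show ?case
      proof
        assume w: "\<omega> \<in> history (Suc t) ?h"
        then have w': "\<omega> \<in> history t h" using history_Suc_subset by blast
        have "X t \<omega> = ?x" "X (Suc t) \<omega> = axis i 1"
          using w by (auto simp: history_def)
        with elim w' have
          "Y t \<omega> - Y' t \<omega> \<le> C + C' + real t * (lam - lam')"
          "Y (Suc t) \<omega> = Y t \<omega> - (f ?x z - lam) + z \<bullet> (axis i 1 - A *v ?x)"
          "Y' (Suc t) \<omega> = Y' t \<omega> - (f' ?x z' - lam') + z' \<bullet> (axis i 1 - A *v ?x)"
          by simp_all
        with i(2) cmp show
          "Y (Suc t) \<omega> - Y' (Suc t) \<omega> \<le> C + C' + real (Suc t) * (lam - lam')"
          by (simp add: inner_diff_left algebra_simps)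
      qed
    qed
    with history_Suc_pos[OF pos i(1)] show ?case by blast
  qed
  \<comment> \<open>For this \<open>t\<close> the upper bound in \<open>descent\<close> lies below
    \<open>- (C + C')\<close>, the least value that the bounds on \<open>Y\<close> and
    \<open>Y'\<close> allow.\<close>
  obtain t :: nat where t: "2 * (C + C') < real t * (lam' - lam)"
    using neg reals_Archimedean3[of "lam' - lam"] by auto
  from descent[of t] obtain h where pos: "prob (history t h) > 0" and
    le: "AE \<omega> in M. \<omega> \<in> history t h \<longrightarrow> Y t \<omega> - Y' t \<omega> \<le> C + C' + real t * (lam - lam')"
    by blast
  have "AE \<omega> in M. \<omega> \<in> history t h \<longrightarrow> False"
    using le C C'
  proof eventually_elim
    case (elim \<omega>)
    then have "\<bar>Y t \<omega>\<bar> \<le> C" "\<bar>Y' t \<omega>\<bar> \<le> C'" by blast+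
    with elim(1) t show ?case by (auto simp: algebra_simps)
  qed
  then show False by (rule AE_history_witness[OF pos]) blast
qed

end
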